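(* Let $d=1$, let $\theta\in C_c^\infty(\mathbb{R}^2)$ with $\theta=1$ on $B(0,R)$ for some $R>0$, and let $F(x,v)=\theta(x,v)\,\mathrm{sign}(x)\,|x|^\alpha$ with $\alpha\in(\tfrac12,1)$. Then the system $$x'=v,\qquad v'=F(x,v)$$ with initial condition $(x(0),v(0))=(x_0,0)$ has infinitely many solutions. In particular, for small time (depending on $R$ and $\alpha$), $(x_t,v_t)=(x_0+At^\beta,\,A\beta t^{\beta-1})$, with $(\beta,A)$ satisfying $$\beta=\frac{2}{1-\alpha},\qquad A=\pm\Big(\frac{1}{\beta(\beta-1)}\Big)^{\frac1{1-\alpha}}=\pm\Big(\frac{(1-\alpha)^2}{2(1+\alpha)}\Big)^{\frac1{1-\alpha}},$$ and also with $A=0$, are solutions.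
   Context: Here $x_0\in\mathbb{R}$, $\mathrm{sign}(x)$ is the sign of the real number $x$, $B(0,R)$ is the ball of radius $R$ centred at the origin of $\mathbb{R}^2$, and $C_c^\infty(\mathbb{R}^2)$ is the space of infinitely differentiable real functions on $\mathbb{R}^2$ with compact support.
   Formalization: The formal statement takes x_0 = 0. For every x_0 ≠ 0 the claim fails: F is locally Lipschitz near (x_0,0), so the solution is unique for small time, and the three listed curves cannot all be solutions. *)

theory Defs
  imports "HOL-Analysis.Analysis"
begin

(* The usual recursion for C^k on the whole space: f is C^(k+1) iff it is differentiable
   everywhere and each directional derivative x \<mapsto> Df(x)v is C^k. *)
primrec C_k :: "nat \<Rightarrow> ('a::euclidean_space \<Rightarrow> real) \<Rightarrow> bool" where
  "C_k 0 f \<longleftrightarrow> continuous_on UNIV f"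
| "C_k (Suc k) f \<longleftrightarrow>
     (\<forall>x. f differentiable (at x)) \<and> (\<forall>v. C_k k (\<lambda>x. frechet_derivative f (at x) v))"

definition C_c_infinity :: "('a::euclidean_space \<Rightarrow> real) set" where
  "C_c_infinity = {f. (\<forall>k. C_k k f) \<and> compact (closure {x. f x \<noteq> 0})}"

definition force :: "(real \<times> real \<Rightarrow> real) \<Rightarrow> real \<Rightarrow> real \<times> real \<Rightarrow> real" where
  "force \<theta> \<alpha> = (\<lambda>(x, v). \<theta> (x, v) * sgn x * \<bar>x\<bar> powr \<alpha>)"

(* z = (x, v) is a classical solution on [0, T] of x' = v, v' = F(x, v), z(0) = z0,
   with one-sided derivatives at the two endpoints. *)
definition solves_kinetic ::
    "(real \<times> real \<Rightarrow> real) \<Rightarrow> real \<times> real \<Rightarrow> real \<Rightarrow> (real \<Rightarrow> real \<times> real) \<Rightarrow> bool" where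
  "solves_kinetic F z0 T z \<longleftrightarrow>
     z 0 = z0 \<and>
     (\<forall>t\<in>{0..T}. (z has_vector_derivative (snd (z t), F (z t))) (at t within {0..T}))"

(* Solutions are restricted to [0, T], since HOL functions that differ only outside [0, T]
   must not be counted as different solutions. *)
definition kinetic_solutions ::
    "(real \<times> real \<Rightarrow> real) \<Rightarrow> real \<times> real \<Rightarrow> real \<Rightarrow> (real \<Rightarrow> real \<times> real) set" where
  "kinetic_solutions F z0 T = (\<lambda>z. restrict z {0..T}) ` {z. solves_kinetic F z0 T z}"

end

theory Submission
  imports Defs
begin

text \<open>
  The force vanishes at the origin but is only Hoelder continuous there, so a particle at rest
  at the origin may either stay or leave. Inside the ball where \<open>\<theta> = 1\<close> the equation is
  \<open>x'' = sgn x * \<bar>x\<bar> powr \<alpha>\<close>. Inserting \<open>x = A * t powr \<beta>\<close>, the powers of \<open>t\<close> agree iff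
  \<open>\<beta> - 2 = \<alpha> * \<beta>\<close>, which determines \<open>\<beta>\<close>, and then the coefficients agree iff \<open>A = 0\<close> or
  \<open>\<bar>A\<bar> powr (1 - \<alpha>) = 1 / (\<beta> * (\<beta> - 1))\<close>, which determines \<open>\<bar>A\<bar>\<close>
  (lemma \<open>force_balance\<close>).

  Since \<open>\<beta> > 2\<close>, the departing motion is glued to the rest solution in a differentiable way, and
  the departure may be delayed to an arbitrary time \<open>s\<close>: replace \<open>t\<close> by the positive part of
  \<open>t - s\<close>. Different \<open>s\<close> give different solutions. The formula is valid only for a time \<open>T0\<close>
  after departure, while the particle is still in the ball. On an arbitrary time interval
  \<open>{0..T}\<close>, the particle is therefore made to depart late, at some \<open>s < T\<close> with
  \<open>T - s \<le> T0\<close>, so that it never leaves the ball; there are infinitely many such \<open>s\<close>.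
\<close>

text \<open>
  The exponent exceeds one, so the two one-sided derivatives at the corner of the positive part
  are both zero.
\<close>

lemma pos_part_powr_has_real_derivative:
  fixes \<gamma> t :: real
  assumes "\<gamma> > 1"
  shows "((\<lambda>t. max 0 t powr \<gamma>) has_real_derivative \<gamma> * max 0 t powr (\<gamma> - 1)) (at t)"
proof -
  consider "t > 0" | "t < 0" | "t = 0" by linarith
  then show ?thesis
  proof cases
    case 1
    have "((\<lambda>t. t powr \<gamma>) has_real_derivative \<gamma> * t powr (\<gamma> - 1)) (at t)"
      using 1 by (rule has_real_derivative_powr)
    then have "((\<lambda>t. max 0 t powr \<gamma>) has_real_derivative \<gamma> * t powr (\<gamma> - 1)) (at t)"
      by (rule has_field_derivative_transform_within_open[where S = "{0<..}"]) (use 1 in auto)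
    with 1 show ?thesis by simp
  next
    case 2
    have "((\<lambda>t. 0) has_real_derivative 0) (at t)" by simp
    then have "((\<lambda>t. max 0 t powr \<gamma>) has_real_derivative 0) (at t)"
      by (rule has_field_derivative_transform_within_open[where S = "{..<0}"]) (use 2 in auto)
    with 2 show ?thesis by simp
  next
    case 3
    have "((\<lambda>h. \<bar>h\<bar> powr (\<gamma> - 1)) \<longlongrightarrow> \<bar>0\<bar> powr (\<gamma> - 1)) (at (0::real))"
      by (rule tendsto_powr'[OF tendsto_rabs[OF tendsto_ident_at] tendsto_const])
        (use assms in auto)
    then have lim: "((\<lambda>h::real. \<bar>h\<bar> powr (\<gamma> - 1)) \<longlongrightarrow> 0) (at 0)" by simp
    have "norm (max 0 h powr \<gamma> / h) \<le> \<bar>h\<bar> powr (\<gamma> - 1)" if "h \<noteq> 0" for h :: real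
    proof (cases "h > 0")
      case True
      then show ?thesis by (simp add: powr_diff)
    next
      case False
      then show ?thesis by simp
    qed
    then have "((\<lambda>h. max 0 h powr \<gamma> / h) \<longlongrightarrow> 0) (at (0::real))"
      by (intro Lim_null_comparison[OF _ lim]) (auto simp: eventually_at intro!: exI[of _ 1])
    with 3 show ?thesis by (simp add: has_field_derivative_iff)
  qed
qed

text \<open>
  Taking the positive part of \<open>t - s\<close> joins rest at the origin until time \<open>s\<close> and the power law
  after it in a single formula, which can be differentiated without a case distinction at \<open>s\<close>.
\<close>

definition delayed_departure :: "real \<Rightarrow> real \<Rightarrow> real \<Rightarrow> real \<Rightarrow> real \<times> real" where
  "delayed_departure \<beta> A s t = (A * max 0 (t - s) powr \<beta>, A * \<beta> * max 0 (t - s) powr (\<beta> - 1))"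

lemma delayed_departure_has_vector_derivative:
  assumes "\<beta> > 2"
  shows "(delayed_departure \<beta> A s has_vector_derivative
           (A * \<beta> * max 0 (t - s) powr (\<beta> - 1), A * \<beta> * (\<beta> - 1) * max 0 (t - s) powr (\<beta> - 2)))
           (at t within S)"
proof -
  have shifted: "((\<lambda>t. max 0 (t - s) powr \<gamma>) has_real_derivative \<gamma> * max 0 (t - s) powr (\<gamma> - 1))
      (at t within S)" if "\<gamma> > 1" for \<gamma>
    using DERIV_chain2[where g = "\<lambda>t. t - s" and x = t and s = S and Db = 1,
        OF pos_part_powr_has_real_derivative[OF that] DERIV_diff[OF DERIV_ident DERIV_const, simplified]]
    by simp
  have "((\<lambda>t. A * max 0 (t - s) powr \<beta>) has_real_derivative
      A * \<beta> * max 0 (t - s) powr (\<beta> - 1)) (at t within S)"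
    using DERIV_cmult[OF shifted[of \<beta>], of A] assms by (simp add: mult.assoc)
  moreover have "((\<lambda>t. A * \<beta> * max 0 (t - s) powr (\<beta> - 1)) has_real_derivative
      A * \<beta> * (\<beta> - 1) * max 0 (t - s) powr (\<beta> - 2)) (at t within S)"
    using DERIV_cmult[OF shifted[of "\<beta> - 1"], of "A * \<beta>"] assms by (simp add: mult.assoc)
  ultimately show ?thesis
    unfolding delayed_departure_def[abs_def] has_real_derivative_iff_has_vector_derivative
    by (rule has_vector_derivative_Pair)
qed

lemma solves_kinetic_delayed_departure:
  assumes "\<beta> > 2" and "s \<ge> 0"
    and balance: "\<And>r. r \<ge> 0 \<Longrightarrow>
      A * \<beta> * (\<beta> - 1) * r powr (\<beta> - 2) = sgn (A * r powr \<beta>) * \<bar>A * r powr \<beta>\<bar> powr \<alpha>"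
    and plateau: "\<And>t. t \<in> {0..T} \<Longrightarrow> \<theta> (delayed_departure \<beta> A s t) = 1"
  shows "solves_kinetic (force \<theta> \<alpha>) (0, 0) T (delayed_departure \<beta> A s)"
  unfolding solves_kinetic_def
proof (intro conjI ballI)
  show "delayed_departure \<beta> A s 0 = (0, 0)"
    using \<open>s \<ge> 0\<close> by (simp add: delayed_departure_def)
next
  fix t assume "t \<in> {0..T}"
  have "force \<theta> \<alpha> (delayed_departure \<beta> A s t)
      = A * \<beta> * (\<beta> - 1) * max 0 (t - s) powr (\<beta> - 2)"
    using plateau[OF \<open>t \<in> {0..T}\<close>] balance[of "max 0 (t - s)"]
    by (simp add: force_def delayed_departure_def)
  moreover have "snd (delayed_departure \<beta> A s t) = A * \<beta> * max 0 (t - s) powr (\<beta> - 1)"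
    by (simp add: delayed_departure_def)
  ultimately show "(delayed_departure \<beta> A s has_vector_derivative
      (snd (delayed_departure \<beta> A s t), force \<theta> \<alpha> (delayed_departure \<beta> A s t)))
      (at t within {0..T})"
    using delayed_departure_has_vector_derivative[OF \<open>\<beta> > 2\<close>, of A s t "{0..T}"] by simp
qed

text \<open>
  The acceleration of the power law equals the force on it: the exponents match because
  \<open>\<beta> - 2 = \<alpha> * \<beta>\<close>, and the coefficients because \<open>a = a powr \<alpha> * a powr (1 - \<alpha>)\<close>.
  The force is odd, so the law for \<open>-a\<close> is the mirror image of that for \<open>a\<close>.
\<close>

lemma force_balance:
  fixes \<alpha> \<beta> a A r :: real
  assumes "0 < \<alpha>" and "\<alpha> < 1"
    and \<beta>: "\<beta> = 2 / (1 - \<alpha>)"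
    and a: "a = (1 / (\<beta> * (\<beta> - 1))) powr (1 / (1 - \<alpha>))"
    and A: "A \<in> {a, - a, 0}" and "r \<ge> 0"
  shows "A * \<beta> * (\<beta> - 1) * r powr (\<beta> - 2) = sgn (A * r powr \<beta>) * \<bar>A * r powr \<beta>\<bar> powr \<alpha>"
proof (cases "r = 0")
  case True
  then show ?thesis by simp
next
  case False
  with \<open>r \<ge> 0\<close> have "r > 0" by simp
  have "\<beta> > 2" using \<open>0 < \<alpha>\<close> \<open>\<alpha> < 1\<close> by (simp add: \<beta> field_simps)
  then have "\<beta> * (\<beta> - 1) > 0" by simp
  have "a > 0" using \<open>\<beta> > 2\<close> by (simp add: a)
  have "a powr (1 - \<alpha>) = 1 / (\<beta> * (\<beta> - 1))"
    using \<open>\<beta> * (\<beta> - 1) > 0\<close> \<open>\<alpha> < 1\<close> by (simp add: a powr_powr)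
  then have "a powr (1 - \<alpha>) * (\<beta> * (\<beta> - 1)) = 1"
    using \<open>\<beta> > 2\<close> by simp
  moreover have "a = a powr \<alpha> * a powr (1 - \<alpha>)"
    using \<open>a > 0\<close> by (simp flip: powr_add)
  ultimately have coeff: "a * \<beta> * (\<beta> - 1) = a powr \<alpha>"
    by (metis mult.assoc mult.right_neutral)
  have expo: "\<beta> - 2 = \<beta> * \<alpha>"
    using \<open>\<alpha> < 1\<close> by (simp add: \<beta> field_simps)
  have "a * \<beta> * (\<beta> - 1) * r powr (\<beta> - 2) = (a * r powr \<beta>) powr \<alpha>"
    using \<open>a > 0\<close> \<open>r > 0\<close> by (simp add: coeff expo powr_mult powr_powr)
  with A \<open>a > 0\<close> \<open>r > 0\<close> show ?thesis
    by (auto simp: sgn_mult abs_mult)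
qed

lemma departure_constant_alternative:
  fixes \<alpha> \<beta> :: real
  assumes "-1 < \<alpha>" and "\<alpha> < 1" and "\<beta> = 2 / (1 - \<alpha>)"
  shows "1 / (\<beta> * (\<beta> - 1)) = (1 - \<alpha>)\<^sup>2 / (2 * (1 + \<alpha>))"
proof -
  have "\<beta> - 1 = (1 + \<alpha>) / (1 - \<alpha>)"
    using assms by (simp add: field_simps)
  then show ?thesis
    using assms by (simp add: power2_eq_square)
qed

text \<open>
  The time spent in the ball after departure depends neither on the cutoff nor on the moment of
  departure, because the motion is continuous and depends only on \<open>t - s\<close>.
\<close>

lemma delayed_departure_in_ball:
  assumes "\<beta> > 2" and "R > 0"
  obtains T0 where "T0 > 0"
    and "\<And>A s t. A \<in> {a, - a, 0} \<Longrightarrow> t - s \<le> T0 \<Longrightarrow> delayed_departure \<beta> A s t \<in> ball 0 R"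
proof -
  have "isCont (delayed_departure \<beta> a 0) 0"
    using has_vector_derivative_continuous[OF delayed_departure_has_vector_derivative[OF \<open>\<beta> > 2\<close>]]
    by simp
  then obtain d where "d > 0"
    and d: "\<And>t. \<bar>t\<bar> < d \<Longrightarrow> dist (delayed_departure \<beta> a 0 t) (delayed_departure \<beta> a 0 0) < R"
    using \<open>R > 0\<close> unfolding continuous_at_eps_delta by (metis dist_real_def diff_zero)
  have near: "norm (delayed_departure \<beta> a 0 t) < R" if "\<bar>t\<bar> < d" for t
    using d[OF that] by (simp add: delayed_departure_def dist_norm zero_prod_def)
  show ?thesis
  proof
    show "d / 2 > 0" using \<open>d > 0\<close> by simp
  next
    fix A s t :: real assume A: "A \<in> {a, - a, 0}" and "t - s \<le> d / 2"
    then have "norm (delayed_departure \<beta> a 0 (max 0 (t - s))) < R"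
      using \<open>d > 0\<close> by (intro near) (simp add: max_def)
    then have "norm (delayed_departure \<beta> a s t) < R"
      by (simp add: delayed_departure_def)
    moreover have "delayed_departure \<beta> (- a) s t = - delayed_departure \<beta> a s t"
      and "delayed_departure \<beta> 0 s t = 0"
      by (simp_all add: delayed_departure_def zero_prod_def)
    ultimately show "delayed_departure \<beta> A s t \<in> ball 0 R"
      using A \<open>R > 0\<close> by (auto simp: norm_minus_cancel)
  qed
qed

text \<open>
  The departure time is recovered from the position at the final time, which is a strictly
  monotone function of the time elapsed since departure.
\<close>

lemma inj_on_restrict_delayed_departure:
  assumes "\<beta> \<noteq> 0" and "A \<noteq> 0" and "T \<ge> 0"
  shows "inj_on (\<lambda>s. restrict (delayed_departure \<beta> A s) {0..T}) {..<T}"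
proof (rule inj_onI)
  fix s s' assume s: "s \<in> {..<T}" "s' \<in> {..<T}"
    and "restrict (delayed_departure \<beta> A s) {0..T} = restrict (delayed_departure \<beta> A s') {0..T}"
  then have "delayed_departure \<beta> A s T = delayed_departure \<beta> A s' T"
    using \<open>T \<ge> 0\<close> by (metis atLeastAtMost_iff order_refl restrict_apply')
  then have "(T - s) powr \<beta> = (T - s') powr \<beta>"
    using s \<open>A \<noteq> 0\<close> by (simp add: delayed_departure_def)
  then have "((T - s) powr \<beta>) powr (1 / \<beta>) = ((T - s') powr \<beta>) powr (1 / \<beta>)"
    by simp
  then show "s = s'"
    using s \<open>\<beta> \<noteq> 0\<close> by (simp add: powr_powr)
qed

theorem proposition2:
  fixes \<alpha> \<beta> a R x0 :: real
  assumes "1/2 < \<alpha>" and "\<alpha> < 1" and "R > 0"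
    and "x0 = 0"
    and \<beta>: "\<beta> = 2 / (1 - \<alpha>)"
    and a: "a = (1 / (\<beta> * (\<beta> - 1))) powr (1 / (1 - \<alpha>))"
  shows "a = ((1 - \<alpha>)\<^sup>2 / (2 * (1 + \<alpha>))) powr (1 / (1 - \<alpha>)) \<and>
         (\<forall>\<theta>\<in>C_c_infinity. (\<forall>z\<in>ball 0 R. \<theta> z = 1) \<longrightarrow>
           (\<forall>T>0. infinite (kinetic_solutions (force \<theta> \<alpha>) (x0, 0) T))) \<and>
         (\<exists>T0>0. \<forall>\<theta>\<in>C_c_infinity. (\<forall>z\<in>ball 0 R. \<theta> z = 1) \<longrightarrow>
           (\<forall>A\<in>{a, - a, 0}. solves_kinetic (force \<theta> \<alpha>) (x0, 0) T0
              (\<lambda>t. (x0 + A * t powr \<beta>, A * \<beta> * t powr (\<beta> - 1)))))"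
proof -
  have "\<alpha> > 0" using \<open>1/2 < \<alpha>\<close> by simp
  then have "\<beta> > 2" using \<open>\<alpha> < 1\<close> by (simp add: \<beta> field_simps)
  then have "a > 0" by (simp add: a)
  obtain T0 where "T0 > 0"
    and in_ball: "\<And>A s t. A \<in> {a, - a, 0} \<Longrightarrow> t - s \<le> T0 \<Longrightarrow> delayed_departure \<beta> A s t \<in> ball 0 R"
    using delayed_departure_in_ball[OF \<open>\<beta> > 2\<close> \<open>R > 0\<close>] by metis
  have solution: "solves_kinetic (force \<theta> \<alpha>) (0, 0) T (delayed_departure \<beta> A s)"
    if "\<forall>z\<in>ball 0 R. \<theta> z = 1" and "A \<in> {a, - a, 0}" and "s \<ge> 0" and "T - s \<le> T0" for \<theta> A s T
    using \<open>\<beta> > 2\<close> \<open>s \<ge> 0\<close> force_balance[OF \<open>\<alpha> > 0\<close> \<open>\<alpha> < 1\<close> \<beta> a \<open>A \<in> _\<close>]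
  proof (rule solves_kinetic_delayed_departure)
    fix t assume "t \<in> {0..T}"
    then have "t - s \<le> T0" using \<open>T - s \<le> T0\<close> by simp
    with that show "\<theta> (delayed_departure \<beta> A s t) = 1" using in_ball by blast
  qed
  have "a = ((1 - \<alpha>)\<^sup>2 / (2 * (1 + \<alpha>))) powr (1 / (1 - \<alpha>))"
    using departure_constant_alternative[OF _ \<open>\<alpha> < 1\<close> \<beta>] \<open>\<alpha> > 0\<close> by (simp add: a)
  moreover have "infinite (kinetic_solutions (force \<theta> \<alpha>) (x0, 0) T)"
    if "\<forall>z\<in>ball 0 R. \<theta> z = 1" and "T > 0" for \<theta> T
  proof -
    let ?D = "{max 0 (T - T0)<..<T}"
    have "infinite ?D"
      using \<open>T > 0\<close> \<open>T0 > 0\<close> by (intro infinite_Ioo) simp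
    moreover have "inj_on (\<lambda>s. restrict (delayed_departure \<beta> a s) {0..T}) ?D"
      by (rule inj_on_subset[OF inj_on_restrict_delayed_departure])
        (use \<open>\<beta> > 2\<close> \<open>a > 0\<close> \<open>T > 0\<close> in auto)
    ultimately have "infinite ((\<lambda>s. restrict (delayed_departure \<beta> a s) {0..T}) ` ?D)"
      by (simp add: finite_image_iff)
    moreover have "(\<lambda>s. restrict (delayed_departure \<beta> a s) {0..T}) ` ?D
        \<subseteq> kinetic_solutions (force \<theta> \<alpha>) (x0, 0) T"
      using solution[OF that(1), of a] \<open>x0 = 0\<close> by (auto simp: kinetic_solutions_def)
    ultimately show ?thesis using infinite_super by blast
  qed
  moreover have "solves_kinetic (force \<theta> \<alpha>) (x0, 0) T0
      (\<lambda>t. (x0 + A * t powr \<beta>, A * \<beta> * t powr (\<beta> - 1)))"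
    if "\<forall>z\<in>ball 0 R. \<theta> z = 1" and "A \<in> {a, - a, 0}" for \<theta> A
  proof -
    let ?z = "\<lambda>t. (A * t powr \<beta>, A * \<beta> * t powr (\<beta> - 1))"
    have eq: "delayed_departure \<beta> A 0 t = ?z t" if "t \<in> {0..T0}" for t
      using that by (simp add: delayed_departure_def)
    have sol: "solves_kinetic (force \<theta> \<alpha>) (0, 0) T0 (delayed_departure \<beta> A 0)"
      by (rule solution) (use that in auto)
    have "solves_kinetic (force \<theta> \<alpha>) (0, 0) T0 ?z"
      unfolding solves_kinetic_def
    proof (intro conjI ballI)
      show "?z 0 = (0, 0)" by simp
    next
      fix t assume t: "t \<in> {0..T0}"
      have "(delayed_departure \<beta> A 0 has_vector_derivative (snd (?z t), force \<theta> \<alpha> (?z t)))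
          (at t within {0..T0})"
        using sol t unfolding solves_kinetic_def by (metis eq)
      then show "(?z has_vector_derivative (snd (?z t), force \<theta> \<alpha> (?z t))) (at t within {0..T0})"
        by (rule has_vector_derivative_transform[OF t eq[symmetric], rotated])
    qed
    then show ?thesis by (simp add: \<open>x0 = 0\<close>)
  qed
  ultimately show ?thesis using \<open>T0 > 0\<close> by blast
qed

end
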